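(* Let $\mathit{Sys}$ be a fault-prone system whose set of locations is partitioned as $\mathit{Loc}=\mathit{ProgLoc}\cup\mathit{LowLoc}\cup\mathit{HighLoc}$, and let $P:\mathit{ProgLoc}\to\{0,1\}$ be a program component of $\mathit{Sys}$. Then $P$ enjoys PNI (probabilistic fault-tolerant non-interference) if and only if $P$ enjoys PoNI (possibilistic fault-tolerant non-interference).
   Context: **Fault-prone system.** $\mathit{Sys}=\{\mathit{Loc},\mathit{Act},\to\}$ where: $\mathit{Loc}$ is a set of locations partitioned into a fault-tolerant subset $T$ and a faulty subset $F$; $\mathit{Act}$ is a set of actions containing a distinguished silent action $\tau$, with a subset $\mathit{LowAct}\subseteq\mathit{Act}$ of publicly observable actions; the set of states is $\mathcal S=\mathit{Loc}\to\{0,1\}$; and $\to\,\subseteq\mathcal S\times\mathit{Act}\times\mathcal S$ is deterministic: for every $S$ there is at most one pair $(a,S')$ with $S\xrightarrow{a}S'$. A state is stuck if it has no outgoing transition. The map $\mathrm{low}:\mathit{Act}\to\mathit{LowAct}\cup\{\tau\}$ is the identity on $\mathit{LowAct}$ and maps every other action to $\tau$. For $L\subseteq F$, $\mathrm{flip}(S,L)$ is the state obtained from $S$ by negating the value of every location in $L$. The locations are also partitioned (independently of $T,F$) as $\mathit{Loc}=\mathit{ProgLoc}\cup\mathit{LowLoc}\cup\mathit{HighLoc}$ (mutually disjoint). A program component is a function $P:\mathit{ProgLoc}\to\{0,1\}$; the program component of a state $S$ is $S|_{\mathit{ProgLoc}}$. Write $S=_{\mathsf L}S'$ if $S|_{\mathit{LowLoc}}=S'|_{\mathit{LowLoc}}$.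 **Fault environment.** An environment $\mathit{Env}$ consists of a set of states $\mathcal E$, a transition relation $\leadsto\,\subseteq\mathcal E\times(\mathit{LowAct}\cup\{\tau\})\times\mathcal E$ such that for every $E\in\mathcal E$ and $a\in\mathit{LowAct}\cup\{\tau\}$ there is a unique $E'$ with $E\stackrel{a}{\leadsto}E'$, and a function $\mathrm{Fault}:\mathcal E\to(\wp(F)\to[0,1])$ such that each $\mathrm{Fault}(E)$ is a probability distribution (mass function) on $\wp(F)$, the powerset of $F$. **Composition $\mathit{Sys}\times\mathit{Env}$.** States are pairs $\langle S,E\rangle$; transitions carry an action and a probability: - (Step) If $S$ is not stuck, $\pi=\{L\subseteq F\mid \mathrm{flip}(S,L)\xrightarrow{a}S'\}$, $p=\sum_{L\in\pi}\mathrm{Fault}(E)(L)$ and $E\stackrel{\mathrm{low}(a)}{\leadsto}E'$, then $\langle S,E\rangle\xrightarrow{a}_p\langle S',E'\rangle$. - (Stuck-1) If $S$ is not stuck, $L\subseteq F$, $\mathrm{flip}(S,L)$ is stuck, $p=\mathrm{Fault}(E)(L)$ and $E\stackrel{\tau}{\leadsto}E'$, then $\langle S,E\rangle\xrightarrow{\tau}_p\langle\mathrm{flip}(S,L),E'\rangle$. - (Stuck-2) If $S$ is stuck and $E\stackrel{\tau}{\leadsto}E'$, then $\langle S,E\rangle\xrightarrow{\tau}_1\langle S,E'\rangle$. Transitions given by different rules or rule instances are regarded as distinct. A run of size $n$ from $Z$ is $r=Z\xrightarrow{a_0}_{p_0}Z_1\cdots\xrightarrow{a_{n-1}}_{p_{n-1}}Z_n$,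 with probability $\Pr(r)=\prod_{i<n}p_i$ and trace $\mathrm{trace}(r)=\mathrm{low}(a_0)\cdots\mathrm{low}(a_{n-1})$. For $t\in(\mathit{LowAct}\cup\{\tau\})^n$, $\Pr_Z(t)$ is the sum of $\Pr(r)$ over all runs $r$ of size $n$ from $Z$ with $\mathrm{trace}(r)=t$. **PNI.** $P$ enjoys PNI if for all states $S,S'$ with $S|_{\mathit{ProgLoc}}=S'|_{\mathit{ProgLoc}}=P$ and $S=_{\mathsf L}S'$, for every state $E$ of every environment $\mathit{Env}$, every $n\ge0$ and every $t\in(\mathit{LowAct}\cup\{\tau\})^n$: $\Pr_{\langle S,E\rangle}(t)=\Pr_{\langle S',E\rangle}(t)$. **Augmented system $\mathit{Sys}^+$.** It has the same states and transitions labelled by pairs $(L,a)$ with $L\subseteq F$, $a\in\mathit{Act}$: (i) if $S$ is not stuck and $\mathrm{flip}(S,L)\xrightarrow{a}S'$, then $S\xrightarrow{L,a}_+S'$; (ii) if $S$ is not stuck but $\mathrm{flip}(S,L)$ is stuck, then $S\xrightarrow{L,\tau}_+\mathrm{flip}(S,L)$; (iii) if $S$ is stuck, then $S\xrightarrow{L,\tau}_+S$ for every $L\subseteq F$. The trace of $S\xrightarrow{L_0,a_0}_+S_1\cdots\xrightarrow{L_{n-1},a_{n-1}}_+S_n$ is the sequence $L_0,\mathrm{low}(a_0),\dots,L_{n-1},\mathrm{low}(a_{n-1})$. Write $S\Rightarrow^t$ if some finite run from $S$ has trace $t$. **PoNI.** $P$ enjoys PoNI if for all states $S,S'$ with $S|_{\mathit{ProgLoc}}=S'|_{\mathit{ProgLoc}}=P$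 and $S=_{\mathsf L}S'$, and for every trace $t$: $S\Rightarrow^t$ if and only if $S'\Rightarrow^t$. *)

theory Defs
  imports "HOL-Probability.Probability"
begin

text \<open>
  The type \<open>'loc\<close> is the set \<open>Loc\<close> of locations and \<open>'act\<close> is the set \<open>Act\<close> of actions; the bit 1
  is \<open>True\<close>.
\<close>

type_synonym 'loc state = "'loc \<Rightarrow> bool"

record ('loc, 'act) system =
  TolLoc :: "'loc set"
  FaultyLoc :: "'loc set"
  Tau :: 'act
  LowAct :: "'act set"
  Trans :: "('loc state \<times> 'act \<times> 'loc state) set"

definition fault_prone_system :: "('loc, 'act) system \<Rightarrow> bool" where
  "fault_prone_system Sys \<longleftrightarrow>
     TolLoc Sys \<union> FaultyLoc Sys = UNIV \<and> TolLoc Sys \<inter> FaultyLoc Sys = {} \<and>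
     (\<forall>S a S' b S''. (S, a, S') \<in> Trans Sys \<longrightarrow> (S, b, S'') \<in> Trans Sys \<longrightarrow> a = b \<and> S' = S'')"

definition stuck :: "('loc, 'act) system \<Rightarrow> 'loc state \<Rightarrow> bool" where
  "stuck Sys S \<longleftrightarrow> (\<nexists>a S'. (S, a, S') \<in> Trans Sys)"

definition low :: "('loc, 'act) system \<Rightarrow> 'act \<Rightarrow> 'act" where
  "low Sys a = (if a \<in> LowAct Sys then a else Tau Sys)"

definition flip :: "'loc state \<Rightarrow> 'loc set \<Rightarrow> 'loc state" where
  "flip S L = (\<lambda>l. if l \<in> L then \<not> S l else S l)"

abbreviation obs :: "('loc, 'act) system \<Rightarrow> 'act set" where
  "obs Sys \<equiv> LowAct Sys \<union> {Tau Sys}"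


section \<open>Fault environments\<close>

record ('loc, 'act, 'env) environment =
  EnvStates :: "'env set"
  EnvTrans :: "('env \<times> 'act \<times> 'env) set"
  Fault :: "'env \<Rightarrow> 'loc set pmf"

definition fault_environment ::
    "('loc, 'act) system \<Rightarrow> ('loc, 'act, 'env) environment \<Rightarrow> bool" where
  "fault_environment Sys Env \<longleftrightarrow>
     EnvTrans Env \<subseteq> EnvStates Env \<times> obs Sys \<times> EnvStates Env \<and>
     (\<forall>E \<in> EnvStates Env. \<forall>a \<in> obs Sys. \<exists>!E'. (E, a, E') \<in> EnvTrans Env) \<and>
     (\<forall>E \<in> EnvStates Env. set_pmf (Fault Env E) \<subseteq> Pow (FaultyLoc Sys))"


section \<open>The composition of a system and an environment\<close>

text \<open>
  Transitions arising from different rules, or from different instances of a rule, are distinct,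
  even if they agree in action, probability and target. A transition therefore also carries the
  name of its rule; together with source, action and target this identifies the rule instance.
\<close>

datatype 'loc rule_name = Step | Stuck1 "'loc set" | Stuck2

inductive comp_trans ::
    "('loc, 'act) system \<Rightarrow> ('loc, 'act, 'env) environment \<Rightarrow> 'loc state \<times> 'env \<Rightarrow>
     'loc rule_name \<Rightarrow> 'act \<Rightarrow> real \<Rightarrow> 'loc state \<times> 'env \<Rightarrow> bool"
  for Sys :: "('loc, 'act) system" and Env :: "('loc, 'act, 'env) environment" where
  step: "\<not> stuck Sys S \<Longrightarrow>
     \<pi> = {L. L \<subseteq> FaultyLoc Sys \<and> (flip S L, a, S') \<in> Trans Sys} \<Longrightarrow>
     p = (\<Sum>\<^sub>\<infinity>L\<in>\<pi>. pmf (Fault Env E) L) \<Longrightarrow>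
     (E, low Sys a, E') \<in> EnvTrans Env \<Longrightarrow>
     comp_trans Sys Env (S, E) Step a p (S', E')"
| stuck1: "\<not> stuck Sys S \<Longrightarrow> L \<subseteq> FaultyLoc Sys \<Longrightarrow> stuck Sys (flip S L) \<Longrightarrow>
     p = pmf (Fault Env E) L \<Longrightarrow>
     (E, Tau Sys, E') \<in> EnvTrans Env \<Longrightarrow>
     comp_trans Sys Env (S, E) (Stuck1 L) (Tau Sys) p (flip S L, E')"
| stuck2: "stuck Sys S \<Longrightarrow>
     (E, Tau Sys, E') \<in> EnvTrans Env \<Longrightarrow>
     comp_trans Sys Env (S, E) Stuck2 (Tau Sys) 1 (S, E')"

type_synonym ('loc, 'act, 'env) comp_run =
  "('loc rule_name \<times> 'act \<times> real \<times> ('loc state \<times> 'env)) list"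

fun comp_run ::
    "('loc, 'act) system \<Rightarrow> ('loc, 'act, 'env) environment \<Rightarrow> 'loc state \<times> 'env \<Rightarrow>
     ('loc, 'act, 'env) comp_run \<Rightarrow> bool" where
  "comp_run Sys Env Z [] \<longleftrightarrow> True"
| "comp_run Sys Env Z ((k, a, p, Z') # r) \<longleftrightarrow>
     comp_trans Sys Env Z k a p Z' \<and> comp_run Sys Env Z' r"

definition run_prob :: "('loc, 'act, 'env) comp_run \<Rightarrow> real" where
  "run_prob r = prod_list (map (\<lambda>(k, a, p, Z). p) r)"

definition run_trace :: "('loc, 'act) system \<Rightarrow> ('loc, 'act, 'env) comp_run \<Rightarrow> 'act list" where
  "run_trace Sys r = map (\<lambda>(k, a, p, Z). low Sys a) r"

definition trace_prob ::
    "('loc, 'act) system \<Rightarrow> ('loc, 'act, 'env) environment \<Rightarrow> 'loc state \<times> 'env \<Rightarrow>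
     'act list \<Rightarrow> real" where
  "trace_prob Sys Env Z t =
     (\<Sum>\<^sub>\<infinity>r \<in> {r. length r = length t \<and> comp_run Sys Env Z r \<and> run_trace Sys r = t}. run_prob r)"


section \<open>Probabilistic non-interference\<close>

text \<open>
  A formula cannot quantify over types, so the type \<open>'env\<close> from which environment states are drawn
  is a parameter. The set of states of an environment is an arbitrary subset of \<open>'env\<close>; hence, for
  infinite \<open>'env\<close>, isomorphic copies of all finite and countable environments are included, and
  environments of any larger cardinality arise by instantiating \<open>'env\<close>.
\<close>

definition PNI ::
    "'env itself \<Rightarrow> ('loc, 'act) system \<Rightarrow> 'loc set \<Rightarrow> 'loc set \<Rightarrow> ('loc \<Rightarrow> bool) \<Rightarrow> bool" where
  "PNI (_ :: 'env itself) Sys ProgLoc LowLoc P \<longleftrightarrow>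
     (\<forall>S S'. restrict S ProgLoc = P \<and> restrict S' ProgLoc = P \<and>
             restrict S LowLoc = restrict S' LowLoc \<longrightarrow>
        (\<forall>Env :: ('loc, 'act, 'env) environment. fault_environment Sys Env \<longrightarrow>
           (\<forall>E \<in> EnvStates Env. \<forall>t \<in> lists (obs Sys).
              trace_prob Sys Env (S, E) t = trace_prob Sys Env (S', E) t)))"


section \<open>The augmented system and possibilistic non-interference\<close>

inductive aug_trans ::
    "('loc, 'act) system \<Rightarrow> 'loc state \<Rightarrow> 'loc set \<Rightarrow> 'act \<Rightarrow> 'loc state \<Rightarrow> bool"
  for Sys :: "('loc, 'act) system" where
  "L \<subseteq> FaultyLoc Sys \<Longrightarrow> \<not> stuck Sys S \<Longrightarrow> (flip S L, a, S') \<in> Trans Sys \<Longrightarrow>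
     aug_trans Sys S L a S'"
| "L \<subseteq> FaultyLoc Sys \<Longrightarrow> \<not> stuck Sys S \<Longrightarrow> stuck Sys (flip S L) \<Longrightarrow>
     aug_trans Sys S L (Tau Sys) (flip S L)"
| "L \<subseteq> FaultyLoc Sys \<Longrightarrow> stuck Sys S \<Longrightarrow> aug_trans Sys S L (Tau Sys) S"

type_synonym ('loc, 'act) aug_run = "('loc set \<times> 'act \<times> 'loc state) list"

fun aug_run :: "('loc, 'act) system \<Rightarrow> 'loc state \<Rightarrow> ('loc, 'act) aug_run \<Rightarrow> bool" where
  "aug_run Sys S [] \<longleftrightarrow> True"
| "aug_run Sys S ((L, a, S') # r) \<longleftrightarrow> aug_trans Sys S L a S' \<and> aug_run Sys S' r"

text \<open>The alternating sequence of fault sets and low actions is represented by a list of pairs.\<close>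

definition aug_trace ::
    "('loc, 'act) system \<Rightarrow> ('loc, 'act) aug_run \<Rightarrow> ('loc set \<times> 'act) list" where
  "aug_trace Sys r = map (\<lambda>(L, a, S). (L, low Sys a)) r"

definition can_trace ::
    "('loc, 'act) system \<Rightarrow> 'loc state \<Rightarrow> ('loc set \<times> 'act) list \<Rightarrow> bool" where
  "can_trace Sys S t \<longleftrightarrow> (\<exists>r. aug_run Sys S r \<and> aug_trace Sys r = t)"

definition PoNI ::
    "('loc, 'act) system \<Rightarrow> 'loc set \<Rightarrow> 'loc set \<Rightarrow> ('loc \<Rightarrow> bool) \<Rightarrow> bool" where
  "PoNI Sys ProgLoc LowLoc P \<longleftrightarrow>
     (\<forall>S S'. restrict S ProgLoc = P \<and> restrict S' ProgLoc = P \<and>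
             restrict S LowLoc = restrict S' LowLoc \<longrightarrow>
        (\<forall>t. can_trace Sys S t \<longleftrightarrow> can_trace Sys S' t))"

end

theory Submission
  imports Defs
begin

text \<open>
  Once the fault set of every step is fixed, the augmented system runs deterministically and never
  blocks. Grouping the runs of the composition by the fault sets that cause them, the probability of
  a trace \<open>a\<^sub>0 \<dots> a\<^sub>n\<^sub>-\<^sub>1\<close> from \<open>\<langle>S, E\<rangle>\<close> is the sum of the products of \<open>Fault(E\<^sub>i)(L\<^sub>i)\<close>, \<open>i < n\<close>, over
  all fault sequences \<open>L\<^sub>0, \<dots>, L\<^sub>n\<^sub>-\<^sub>1\<close> under which \<open>S\<close> emits the trace; here \<open>E\<^sub>i\<close> depends only on \<open>E\<close>
  and \<open>a\<^sub>0 \<dots> a\<^sub>i\<^sub>-\<^sub>1\<close>. Under PoNI the fault sequences to be summed over are the same for both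
  states. Conversely, an environment that injects a prescribed sequence of fault sets with
  probability 1 turns trace probabilities into the 0/1 indicator of a trace of the augmented
  system.
\<close>

section \<open>The augmented system as a function of state and fault set\<close>

lemma low_Tau [simp]: "low Sys (Tau Sys) = Tau Sys"
  by (simp add: low_def)

lemma trans_deterministic:
  assumes "fault_prone_system Sys" "(S, a, S') \<in> Trans Sys" "(S, b, S'') \<in> Trans Sys"
  shows "b = a \<and> S'' = S'"
  using assms unfolding fault_prone_system_def by blast

text \<open>In the last branch \<open>flip S L\<close> has a transition, and determinism of the
  system makes it unique, so \<open>THE\<close> denotes it. The function is total: no run is ever
  blocked.\<close>

definition aug_step :: "('loc, 'act) system \<Rightarrow> 'loc state \<Rightarrow> 'loc set \<Rightarrow> 'act \<times> 'loc state" where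
  "aug_step Sys S L =
     (if stuck Sys S then (Tau Sys, S)
      else if stuck Sys (flip S L) then (Tau Sys, flip S L)
      else (THE aS. (flip S L, aS) \<in> Trans Sys))"

lemma aug_step_trans:
  assumes "fault_prone_system Sys" "\<not> stuck Sys S" "(flip S L, a, S') \<in> Trans Sys"
  shows "aug_step Sys S L = (a, S')"
proof -
  have "\<not> stuck Sys (flip S L)"
    using assms(3) by (auto simp: stuck_def)
  moreover have "(THE aS. (flip S L, aS) \<in> Trans Sys) = (a, S')"
  proof (rule the_equality)
    show "aS = (a, S')" if "(flip S L, aS) \<in> Trans Sys" for aS
      using trans_deterministic[OF assms(1,3), of "fst aS" "snd aS"] that
      by (simp add: prod_eq_iff)
  qed (rule assms(3))
  ultimately show ?thesis
    using assms(2) by (simp add: aug_step_def)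
qed

lemma aug_trans_iff_aug_step:
  assumes "fault_prone_system Sys"
  shows "aug_trans Sys S L a S' \<longleftrightarrow> L \<subseteq> FaultyLoc Sys \<and> aug_step Sys S L = (a, S')"
proof (intro iffI conjI; (elim conjE)?)
  assume "aug_trans Sys S L a S'"
  then show "aug_step Sys S L = (a, S')"
    by cases (simp_all add: aug_step_trans[OF assms], simp_all add: aug_step_def)
  show "L \<subseteq> FaultyLoc Sys"
    using \<open>aug_trans Sys S L a S'\<close> by cases
next
  assume L: "L \<subseteq> FaultyLoc Sys" and eq: "aug_step Sys S L = (a, S')"
  show "aug_trans Sys S L a S'"
  proof (cases "stuck Sys S \<or> stuck Sys (flip S L)")
    case True
    with L eq show ?thesis
      by (auto simp: aug_step_def aug_trans.simps split: if_splits)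
  next
    case False
    then obtain b S'' where "(flip S L, b, S'') \<in> Trans Sys"
      unfolding stuck_def by blast
    with False L eq aug_step_trans[OF assms] show ?thesis
      by (auto simp: aug_trans.simps)
  qed
qed

lemma can_trace_Nil [simp]: "can_trace Sys S []"
  by (auto simp: can_trace_def aug_trace_def intro: exI[of _ "[]"])

text \<open>A fault set determines both the action and the successor, so the existential quantifier
  over runs disappears and traces can be treated by recursion.\<close>

lemma can_trace_Cons:
  assumes "fault_prone_system Sys"
  shows "can_trace Sys S ((L, x) # t) \<longleftrightarrow>
    L \<subseteq> FaultyLoc Sys \<and> low Sys (fst (aug_step Sys S L)) = x \<and>
    can_trace Sys (snd (aug_step Sys S L)) t"
proof -
  have "can_trace Sys S ((L, x) # t) \<longleftrightarrow>
      (\<exists>a S' r. aug_trans Sys S L a S' \<and> aug_run Sys S' r \<and> low Sys a = x \<and> aug_trace Sys r = t)"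
    unfolding can_trace_def
  proof (intro iffI; (elim exE conjE)?)
    fix r
    assume "aug_run Sys S r" "aug_trace Sys r = (L, x) # t"
    then show "\<exists>a S' r. aug_trans Sys S L a S' \<and> aug_run Sys S' r \<and> low Sys a = x \<and> aug_trace Sys r = t"
      by (cases r) (fastforce simp: aug_trace_def)+
  next
    fix a S' r
    assume "aug_trans Sys S L a S'" "aug_run Sys S' r" "low Sys a = x" "aug_trace Sys r = t"
    then show "\<exists>r. aug_run Sys S r \<and> aug_trace Sys r = (L, x) # t"
      by (intro exI[of _ "(L, a, S') # r"]) (auto simp: aug_trace_def)
  qed
  then show ?thesis
    unfolding aug_trans_iff_aug_step[OF assms] can_trace_def
    by (cases "aug_step Sys S L") auto
qed

section \<open>Trace probabilities as nested sums over fault sets\<close>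

abbreviation fault_sets :: "('loc, 'act) system \<Rightarrow> 'loc state \<Rightarrow> 'act \<Rightarrow> 'loc set set" where
  "fault_sets Sys S x \<equiv> {L. L \<subseteq> FaultyLoc Sys \<and> low Sys (fst (aug_step Sys S L)) = x}"

abbreviation env_step :: "('loc, 'act, 'env) environment \<Rightarrow> 'env \<Rightarrow> 'act \<Rightarrow> 'env" where
  "env_step Env E x \<equiv> (THE E'. (E, x, E') \<in> EnvTrans Env)"

text \<open>The sum over fault sequences is unfolded one step at a time. The next environment state
  depends on the emitted \<open>x\<close> alone, not on the fault set that caused it.\<close>

fun fault_prob ::
    "('loc, 'act) system \<Rightarrow> ('loc, 'act, 'env) environment \<Rightarrow> 'loc state \<Rightarrow> 'env \<Rightarrow>
     'act list \<Rightarrow> real" where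
  "fault_prob Sys Env S E [] = 1"
| "fault_prob Sys Env S E (x # t) =
     (\<Sum>\<^sub>\<infinity>L\<in>fault_sets Sys S x. pmf (Fault Env E) L *
        fault_prob Sys Env (snd (aug_step Sys S L)) (env_step Env E x) t)"

lemma pmf_summable_on: "pmf p summable_on A"
  using pmf_abs_summable[of p A] by (simp add: abs_summable_equivalent[symmetric])

lemma infsum_pmf_eq_measure: "(\<Sum>\<^sub>\<infinity>x\<in>A. pmf p x) = measure (measure_pmf p) A"
  by (simp add: measure_pmf_conv_infsetsum infsetsum_infsum pmf_abs_summable)

lemma fault_prob_nonneg: "0 \<le> fault_prob Sys Env S E t"
  by (induction t arbitrary: S E) (auto intro!: infsum_nonneg)

text \<open>The two claims need a joint induction: comparing the sum with the total mass of the
  distribution requires summability for the shorter trace, and summability follows by domination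
  from the bound. The successor map \<open>f\<close> is arbitrary so that the hypothesis fits every
  state.\<close>

lemma fault_prob_le_1: "fault_prob Sys Env S E t \<le> 1"
  and fault_prob_summable:
    "(\<lambda>L. pmf (Fault Env E) L * fault_prob Sys Env (f L) E' t) summable_on A"
proof (induction t arbitrary: S E E' f A)
  case Nil
  { case 1 then show ?case by simp }
  { case 2 then show ?case by (simp add: pmf_summable_on) }
next
  case (Cons x t)
  have le1: "fault_prob Sys Env S E (x # t) \<le> 1" for S E
  proof -
    have "fault_prob Sys Env S E (x # t) \<le> (\<Sum>\<^sub>\<infinity>L\<in>fault_sets Sys S x. pmf (Fault Env E) L)"
      unfolding fault_prob.simps
      by (intro infsum_mono Cons.IH(2) pmf_summable_on mult_left_le Cons.IH(1) pmf_nonneg)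
    also have "\<dots> \<le> 1"
      by (simp add: infsum_pmf_eq_measure)
    finally show ?thesis .
  qed
  { case 1 show ?case by (rule le1) }
  { case 2 show ?case
      by (intro summable_on_comparison_test[OF pmf_summable_on[of "Fault Env E"]] mult_left_le le1
          mult_nonneg_nonneg pmf_nonneg fault_prob_nonneg) }
qed

section \<open>Transitions of the composition and the fault sets behind them\<close>

text \<open>
  The transition of the composition in which the fault set \<open>L\<close> participates. An instance of the
  rule \<open>step\<close> whose set \<open>\<pi>\<close> is empty is not of this form, but has probability 0.
\<close>

definition comp_step ::
    "('loc, 'act) system \<Rightarrow> ('loc, 'act, 'env) environment \<Rightarrow> 'loc state \<Rightarrow> 'env \<Rightarrow> 'env \<Rightarrow>
     'loc set \<Rightarrow> 'loc rule_name \<times> 'act \<times> real \<times> 'loc state \<times> 'env" where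
  "comp_step Sys Env S E E' L =
     (let (a, S') = aug_step Sys S L in
      if stuck Sys S then (Stuck2, a, 1, S', E')
      else if stuck Sys (flip S L) then (Stuck1 L, a, pmf (Fault Env E) L, S', E')
      else (Step, a,
        \<Sum>\<^sub>\<infinity>K\<in>{K. K \<subseteq> FaultyLoc Sys \<and> (flip S K, a, S') \<in> Trans Sys}. pmf (Fault Env E) K, S', E'))"

lemma comp_trans_comp_step:
  assumes "fault_prone_system Sys" "L \<subseteq> FaultyLoc Sys"
    and "(E, low Sys (fst (aug_step Sys S L)), E') \<in> EnvTrans Env"
    and "comp_step Sys Env S E E' L = (k, a, p, Z)"
  shows "comp_trans Sys Env (S, E) k a p Z" "low Sys a = low Sys (fst (aug_step Sys S L))"
proof -
  obtain b S' where bS: "aug_step Sys S L = (b, S')"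
    by (cases "aug_step Sys S L")
  then have "aug_trans Sys S L b S'"
    using assms(1,2) by (simp add: aug_trans_iff_aug_step)
  then show "comp_trans Sys Env (S, E) k a p Z"
    using assms(2-4) bS
    by cases (auto simp: comp_step_def comp_trans.simps stuck_def split: if_splits)
  show "low Sys a = low Sys (fst (aug_step Sys S L))"
    using assms(4) bS by (auto simp: comp_step_def split: if_splits)
qed

text \<open>Each probability is the mass of the fibre of \<open>comp_step\<close>. For
  \<open>step\<close> the fibre is the set \<pi>, possibly empty; for \<open>stuck1\<close> it is a
  singleton, since the rule name records \<open>L\<close>; for \<open>stuck2\<close> it is the whole
  powerset of faulty locations, of mass 1.\<close>

lemma comp_trans_prob:
  assumes sys: "fault_prone_system Sys" and env: "fault_environment Sys Env"
    and E: "E \<in> EnvStates Env"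
    and ct: "comp_trans Sys Env (S, E) k a p (S', E')"
  shows "p = (\<Sum>\<^sub>\<infinity>L\<in>{L. L \<subseteq> FaultyLoc Sys \<and> comp_step Sys Env S E E' L = (k, a, p, S', E')}.
               pmf (Fault Env E) L)" (is "_ = infsum _ ?B")
  using ct
proof cases
  case (step \<pi>)
  have "?B = \<pi>"
  proof (intro equalityI subsetI)
    fix L assume "L \<in> ?B"
    then have "L \<subseteq> FaultyLoc Sys" "aug_step Sys S L = (a, S')" "\<not> stuck Sys (flip S L)"
      using step by (auto simp: comp_step_def split: prod.splits if_splits)
    then have "aug_trans Sys S L a S'" "\<not> stuck Sys (flip S L)"
      using sys by (auto simp: aug_trans_iff_aug_step)
    then show "L \<in> \<pi>"
      using step by (auto simp: aug_trans.simps)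
  next
    fix L assume "L \<in> \<pi>"
    then have L: "L \<subseteq> FaultyLoc Sys" "(flip S L, a, S') \<in> Trans Sys"
      using step by auto
    then have "\<not> stuck Sys (flip S L)" "aug_step Sys S L = (a, S')"
      using aug_step_trans[OF sys] step by (auto simp: stuck_def)
    then show "L \<in> ?B"
      using L step by (simp add: comp_step_def)
  qed
  then show ?thesis using step by simp
next
  case (stuck1 L)
  then have "?B = {L}"
    by (auto simp: comp_step_def aug_step_def split: if_splits prod.splits)
  then show ?thesis using stuck1 by simp
next
  case stuck2
  then have "?B = Pow (FaultyLoc Sys)"
    by (auto simp: comp_step_def aug_step_def)
  moreover have "measure (measure_pmf (Fault Env E)) (Pow (FaultyLoc Sys)) = 1"
    using env E by (subst measure_pmf.prob_eq_1)
      (fastforce simp: fault_environment_def AE_measure_pmf_iff)+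
  ultimately show ?thesis using stuck2 by (simp add: infsum_pmf_eq_measure)
qed

lemma comp_trans_env_trans:
  "comp_trans Sys Env (S, E) k a p (S', E') \<Longrightarrow> (E, low Sys a, E') \<in> EnvTrans Env"
  by (cases rule: comp_trans.cases) auto

lemma comp_trans_prob_nonneg: "comp_trans Sys Env Z k a p Z' \<Longrightarrow> 0 \<le> p"
  by (cases rule: comp_trans.cases) (auto intro!: infsum_nonneg)

lemma run_prob_Nil [simp]: "run_prob [] = 1"
  by (simp add: run_prob_def)

lemma run_prob_Cons [simp]: "run_prob ((k, a, p, Z) # r) = p * run_prob r"
  by (simp add: run_prob_def)

lemma run_prob_nonneg: "comp_run Sys Env Z r \<Longrightarrow> 0 \<le> run_prob r"
  by (induction Sys Env Z r rule: comp_run.induct)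
    (auto intro: mult_nonneg_nonneg comp_trans_prob_nonneg)

lemma env_step:
  assumes "fault_environment Sys Env" "E \<in> EnvStates Env" "x \<in> obs Sys"
  shows "(E, x, E') \<in> EnvTrans Env \<longleftrightarrow> E' = env_step Env E x"
    and "env_step Env E x \<in> EnvStates Env"
proof -
  have ex1: "\<exists>!E'. (E, x, E') \<in> EnvTrans Env"
    using assms unfolding fault_environment_def by blast
  show eq: "(E, x, E') \<in> EnvTrans Env \<longleftrightarrow> E' = env_step Env E x" for E'
    using theI'[OF ex1] the1_equality[OF ex1] by metis
  have "(E, x, env_step Env E x) \<in> EnvTrans Env"
    using eq by blast
  then show "env_step Env E x \<in> EnvStates Env"
    using assms(1) by (auto simp: fault_environment_def)
qed

section \<open>Summation over transitions and over runs\<close>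

text \<open>The fibres of \<open>comp_step\<close> partition the fault sets that emit
  \<open>x\<close>. The target is constant on a fibre, so its value factors out and the remaining
  mass is \<open>p\<close>.\<close>

lemma has_sum_comp_trans:
  assumes sys: "fault_prone_system Sys" and env: "fault_environment Sys Env"
    and E: "E \<in> EnvStates Env" and x: "x \<in> obs Sys"
  shows "((\<lambda>(k, a, p, S', E'). p * fault_prob Sys Env S' E' t) has_sum fault_prob Sys Env S E (x # t))
           {(k, a, p, Z). comp_trans Sys Env (S, E) k a p Z \<and> low Sys a = x}"
proof -
  define E' where "E' = env_step Env E x"
  define C where "C = {(k, a, p, Z). comp_trans Sys Env (S, E) k a p Z \<and> low Sys a = x}"
  define h where "h = comp_step Sys Env S E E'"
  define B where "B c = {L. L \<subseteq> FaultyLoc Sys \<and> h L = c}" for c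
  define V where "V S' = fault_prob Sys Env S' E' t" for S'
  have E': "(E, x, F) \<in> EnvTrans Env \<longleftrightarrow> F = E'" for F
    unfolding E'_def by (rule env_step(1)[OF env E x])
  have target: "fst (snd (snd (snd (h L)))) = snd (aug_step Sys S L)"
    "fst (snd (h L)) = fst (aug_step Sys S L)" for L
    by (simp_all add: h_def comp_step_def split: prod.splits)
  \<comment> \<open>Pairing each fault set with its transition turns the single sum into a double
    sum: over transitions, then over their fibres. Transitions with an empty fibre contribute
    0.\<close>
  have "bij_betw (\<lambda>L. (h L, L)) (fault_sets Sys S x) (Sigma C B)"
  proof (rule bij_betwI[where g = snd])
    show "(\<lambda>L. (h L, L)) \<in> fault_sets Sys S x \<rightarrow> Sigma C B"
    proof
      fix L assume L: "L \<in> fault_sets Sys S x"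
      obtain k a p Z where hL: "h L = (k, a, p, Z)"
        by (metis surj_pair)
      have "comp_trans Sys Env (S, E) k a p Z" "low Sys a = x"
        using comp_trans_comp_step[OF sys, of L E S E' Env k a p Z] L hL E'
        by (auto simp: h_def)
      then show "(h L, L) \<in> Sigma C B"
        using L hL by (auto simp: C_def B_def)
    qed
    show "snd \<in> Sigma C B \<rightarrow> fault_sets Sys S x"
    proof
      fix cL assume "cL \<in> Sigma C B"
      then have "snd cL \<subseteq> FaultyLoc Sys" "h (snd cL) \<in> C"
        by (auto simp: B_def)
      then show "snd cL \<in> fault_sets Sys S x"
        using target(2)[of "snd cL"] by (auto simp: C_def)
    qed
  qed (auto simp: B_def)
  moreover have "((\<lambda>L. pmf (Fault Env E) L * V (snd (aug_step Sys S L))) has_sum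
      fault_prob Sys Env S E (x # t)) (fault_sets Sys S x)"
    unfolding fault_prob.simps V_def E'_def by (intro has_sum_infsum fault_prob_summable)
  ultimately have "((\<lambda>(c, L). pmf (Fault Env E) L * V (snd (aug_step Sys S L))) has_sum
      fault_prob Sys Env S E (x # t)) (Sigma C B)"
    by (subst has_sum_reindex_bij_betw[symmetric]) auto
  then have "((\<lambda>c. \<Sum>\<^sub>\<infinity>L\<in>B c. pmf (Fault Env E) L * V (snd (aug_step Sys S L))) has_sum
      fault_prob Sys Env S E (x # t)) C"
    by (simp add: has_sum_iff summable_on_Sigma_banach infsum_Sigma'_banach del: fault_prob.simps)
  moreover have "(\<Sum>\<^sub>\<infinity>L\<in>B c. pmf (Fault Env E) L * V (snd (aug_step Sys S L))) =
      (case c of (k, a, p, S', E') \<Rightarrow> p * fault_prob Sys Env S' E' t)" if "c \<in> C" for c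
  proof -
    obtain k a p S' F where c: "c = (k, a, p, S', F)"
      by (metis surj_pair)
    with that have ct: "comp_trans Sys Env (S, E) k a p (S', F)" and "low Sys a = x"
      by (auto simp: C_def)
    then have F: "F = E'"
      using comp_trans_env_trans[OF ct] E' by simp
    have "(\<Sum>\<^sub>\<infinity>L\<in>B c. pmf (Fault Env E) L * V (snd (aug_step Sys S L))) =
        (\<Sum>\<^sub>\<infinity>L\<in>B c. pmf (Fault Env E) L * V S')"
      by (intro infsum_cong) (auto simp: B_def c target(1)[symmetric])
    also have "\<dots> = (\<Sum>\<^sub>\<infinity>L\<in>B c. pmf (Fault Env E) L) * V S'"
      by (rule infsum_cmult_left')
    also have "(\<Sum>\<^sub>\<infinity>L\<in>B c. pmf (Fault Env E) L) = p"
      using comp_trans_prob[OF sys env E ct] by (simp add: B_def c h_def F)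
    finally show ?thesis
      by (simp add: c V_def F)
  qed
  ultimately show ?thesis
    unfolding C_def[symmetric] by (simp cong: has_sum_cong)
qed

text \<open>Runs are split at their first transition. Using \<open>has_sum\<close> carries
  convergence through the induction, whereas a divergent \<open>infsum\<close> would silently be
  0.\<close>

lemma has_sum_run_prob:
  fixes Sys :: "('loc, 'act) system" and Env :: "('loc, 'act, 'env) environment"
  assumes sys: "fault_prone_system Sys" and env: "fault_environment Sys Env"
  shows "E \<in> EnvStates Env \<Longrightarrow> t \<in> lists (obs Sys) \<Longrightarrow>
    (run_prob has_sum fault_prob Sys Env S E t)
      {r. length r = length t \<and> comp_run Sys Env (S, E) r \<and> run_trace Sys r = t}"
proof (induction t arbitrary: S E)
  case Nil
  have "{r. length r = length [] \<and> comp_run Sys Env (S, E) r \<and> run_trace Sys r = []} = {[]}"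
    by (auto simp: run_trace_def)
  then show ?case
    using has_sum_finite[of "{[]}" "run_prob"] by simp
next
  case (Cons x t)
  define R where "R Z = {r. length r = length t \<and> comp_run Sys Env Z r \<and> run_trace Sys r = t}" for Z
  define C where "C = {(k, a, p, Z). comp_trans Sys Env (S, E) k a p Z \<and> low Sys a = x}"
  define prob :: "'loc rule_name \<times> 'act \<times> real \<times> 'loc state \<times> 'env \<Rightarrow> real"
    where "prob = (\<lambda>(k, a, p, Z). p)"
  define target :: "'loc rule_name \<times> 'act \<times> real \<times> 'loc state \<times> 'env \<Rightarrow> 'loc state \<times> 'env"
    where "target = (\<lambda>(k, a, p, Z). Z)"
  define g :: "'loc rule_name \<times> 'act \<times> real \<times> 'loc state \<times> 'env \<Rightarrow> real"
    where "g = (\<lambda>(k, a, p, S', E'). p * fault_prob Sys Env S' E' t)"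
  have x: "x \<in> obs Sys" and t: "t \<in> lists (obs Sys)"
    using Cons.prems by auto
  have inner: "((\<lambda>r. prob c * run_prob r) has_sum g c) (R (target c))" if c: "c \<in> C" for c
  proof -
    obtain k a p S' F where c_eq: "c = (k, a, p, S', F)"
      by (metis surj_pair)
    with c have "(E, x, F) \<in> EnvTrans Env"
      by (auto simp: C_def dest: comp_trans_env_trans)
    then have "F \<in> EnvStates Env"
      using env by (auto simp: fault_environment_def)
    then show ?thesis
      unfolding R_def using Cons.IH[OF _ t, of F S']
      by (simp add: c_eq prob_def target_def g_def has_sum_cmult_right)
  qed
  have outer: "(g has_sum fault_prob Sys Env S E (x # t)) C"
    unfolding g_def C_def by (rule has_sum_comp_trans[OF sys env Cons.prems(1) x])
  have "((\<lambda>(c, r). prob c * run_prob r) has_sum fault_prob Sys Env S E (x # t))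
      (Sigma C (\<lambda>c. R (target c)))"
  proof (rule has_sum_SigmaI[OF _ outer])
    show "(\<lambda>(c, r). prob c * run_prob r) summable_on (Sigma C (\<lambda>c. R (target c)))"
    \<comment> \<open>All terms are nonnegative, so convergence of the iterated sum gives
      convergence over the pairs.\<close>
    proof (rule summable_on_SigmaI)
      show "g summable_on C"
        using outer by (rule has_sum_imp_summable)
    qed (use inner in \<open>auto simp: C_def R_def prob_def
          intro!: mult_nonneg_nonneg intro: comp_trans_prob_nonneg run_prob_nonneg\<close>)
  qed (use inner in simp)
  also have "(\<lambda>(c, r). prob c * run_prob r) = (\<lambda>cr. run_prob (case cr of (c, r) \<Rightarrow> c # r))"
    by (auto simp: prob_def fun_eq_iff)
  also have "(\<dots> has_sum fault_prob Sys Env S E (x # t)) (Sigma C (\<lambda>c. R (target c))) \<longleftrightarrow>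
      (run_prob has_sum fault_prob Sys Env S E (x # t))
        {r. length r = length (x # t) \<and> comp_run Sys Env (S, E) r \<and> run_trace Sys r = x # t}"
    by (rule has_sum_reindex_bij_betw, rule bij_betwI[where g = "\<lambda>r. (hd r, tl r)"])
      (auto simp: C_def R_def target_def run_trace_def length_Suc_conv)
  finally show ?case .
qed

lemma trace_prob_eq_fault_prob:
  assumes "fault_prone_system Sys" "fault_environment Sys Env"
    and "E \<in> EnvStates Env" "t \<in> lists (obs Sys)"
  shows "trace_prob Sys Env (S, E) t = fault_prob Sys Env S E t"
  unfolding trace_prob_def by (intro infsumI has_sum_run_prob assms)

section \<open>From possibilistic to probabilistic non-interference\<close>

lemma fault_prob_cong:
  assumes sys: "fault_prone_system Sys"
  shows "(\<And>u. can_trace Sys S u \<longleftrightarrow> can_trace Sys S' u) \<Longrightarrow>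
    fault_prob Sys Env S E t = fault_prob Sys Env S' E t"
proof (induction t arbitrary: S S' E)
  case (Cons x t)
  \<comment> \<open>A trace of length one reveals the low action that \<open>L\<close> causes;
    longer traces then hand the equivalence on to the successors under \<open>L\<close>.\<close>
  have lab: "low Sys (fst (aug_step Sys S L)) = low Sys (fst (aug_step Sys S' L))"
    if "L \<subseteq> FaultyLoc Sys" for L
    using Cons.prems[of "[(L, low Sys (fst (aug_step Sys S L)))]"] that
    by (simp add: can_trace_Cons[OF sys])
  have "can_trace Sys (snd (aug_step Sys S L)) u \<longleftrightarrow> can_trace Sys (snd (aug_step Sys S' L)) u"
    if "L \<subseteq> FaultyLoc Sys" for L u
    using Cons.prems[of "(L, low Sys (fst (aug_step Sys S L))) # u"] that lab
    by (simp add: can_trace_Cons[OF sys])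
  note IH = Cons.IH[OF this]
  have "fault_sets Sys S x = fault_sets Sys S' x"
    using lab by auto
  then show ?case
    by (auto intro!: infsum_cong simp: IH)
qed simp

section \<open>From probabilistic to possibilistic non-interference\<close>

text \<open>The environment is a clock: \<open>e i\<close> is time \<open>i\<close>, every
  observation advances it by one, and \<open>inv e\<close> reads the time to select the fault set
  injected with certainty.\<close>

definition injecting_env ::
    "('loc, 'act) system \<Rightarrow> (nat \<Rightarrow> 'env) \<Rightarrow> (nat \<Rightarrow> 'loc set) \<Rightarrow> ('loc, 'act, 'env) environment" where
  "injecting_env Sys e Ls = \<lparr>EnvStates = range e,
     EnvTrans = {(e i, a, e (Suc i)) | i a. a \<in> obs Sys},
     Fault = (\<lambda>E. return_pmf (Ls (inv e E)))\<rparr>"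

lemma fault_environment_injecting_env:
  assumes "inj e" "\<And>i. Ls i \<subseteq> FaultyLoc Sys"
  shows "fault_environment Sys (injecting_env Sys e Ls)"
  using assms by (auto simp: fault_environment_def injecting_env_def dest: injD)

text \<open>A point mass leaves at most one term of each sum, so only the prescribed fault sequence
  counts. The start time \<open>i\<close> is general because the induction advances the
  clock.\<close>

lemma fault_prob_injecting_env:
  assumes sys: "fault_prone_system Sys" and e: "inj e" and Ls: "\<And>i. Ls i \<subseteq> FaultyLoc Sys"
  shows "t \<in> lists (obs Sys) \<Longrightarrow>
    fault_prob Sys (injecting_env Sys e Ls) S (e i) t =
    (if can_trace Sys S (zip (map Ls [i..<i + length t]) t) then 1 else 0)"
proof (induction t arbitrary: S i)
  case (Cons x t)
  let ?Env = "injecting_env Sys e Ls"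
  let ?L = "Ls i"
  have step: "env_step ?Env (e i) x = e (Suc i)"
    using Cons.prems e by (auto simp: injecting_env_def dest: injD)
  have fault: "pmf (Fault ?Env (e i)) L = (if L = ?L then 1 else 0)" for L
    using e by (simp add: injecting_env_def pmf_return)
  have "fault_prob Sys ?Env S (e i) (x # t) =
      (\<Sum>\<^sub>\<infinity>L\<in>fault_sets Sys S x \<inter> {?L}. fault_prob Sys ?Env (snd (aug_step Sys S L)) (e (Suc i)) t)"
    unfolding fault_prob.simps step by (rule infsum_cong_neutral) (auto simp: fault)
  also have "\<dots> = (if low Sys (fst (aug_step Sys S ?L)) = x
      then fault_prob Sys ?Env (snd (aug_step Sys S ?L)) (e (Suc i)) t else 0)"
    using Ls[of i] by auto
  also have "\<dots> = (if can_trace Sys S ((?L, x) # zip (map Ls [Suc i..<Suc i + length t]) t) then 1 else 0)"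
    using Cons.IH[of "snd (aug_step Sys S ?L)" "Suc i"] Cons.prems Ls[of i]
    by (simp add: can_trace_Cons[OF sys])
  also have "(?L, x) # zip (map Ls [Suc i..<Suc i + length t]) t =
      zip (map Ls [i..<i + length (x # t)]) (x # t)"
    by (simp add: upt_conv_Cons del: upt_Suc)
  finally show ?case .
qed simp

lemma can_trace_obs:
  assumes "can_trace Sys S u"
  shows "set (map fst u) \<subseteq> Pow (FaultyLoc Sys)" "map snd u \<in> lists (obs Sys)"
proof -
  obtain r where r: "aug_run Sys S r" and u: "aug_trace Sys r = u"
    using assms by (auto simp: can_trace_def)
  have "set (map fst (aug_trace Sys r)) \<subseteq> Pow (FaultyLoc Sys)"
    using r by (induction Sys S r rule: aug_run.induct) (auto simp: aug_trace_def aug_trans.simps)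
  then show "set (map fst u) \<subseteq> Pow (FaultyLoc Sys)"
    using u by simp
  show "map snd u \<in> lists (obs Sys)"
    unfolding u[symmetric] by (auto simp: aug_trace_def low_def)
qed

text \<open>The trace \<open>u\<close> is tested by the environment that injects exactly its fault
  sets; infinitely many environment states provide the clock. One direction suffices, as the
  situation is symmetric in \<open>S\<close> and \<open>S'\<close>.\<close>

lemma can_trace_transfer:
  fixes Sys :: "('loc, 'act) system" and S S' :: "'loc state"
  assumes sys: "fault_prone_system Sys" and inf: "infinite (UNIV :: 'env set)"
    and eq: "\<And>(Env :: ('loc, 'act, 'env) environment) E t.
      fault_environment Sys Env \<Longrightarrow> E \<in> EnvStates Env \<Longrightarrow> t \<in> lists (obs Sys) \<Longrightarrow>
      trace_prob Sys Env (S, E) t = trace_prob Sys Env (S', E) t"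
    and u: "can_trace Sys S u"
  shows "can_trace Sys S' u"
proof -
  obtain e :: "nat \<Rightarrow> 'env" where e: "inj e"
    using infinite_countable_subset[OF inf] by auto
  \<comment> \<open>The clock runs on past the end of \<open>u\<close>; the default
    \<open>{}\<close> keeps every injected set within the faulty locations.\<close>
  define Ls where "Ls i = (if i < length u then fst (u ! i) else {})" for i
  have Ls: "Ls i \<subseteq> FaultyLoc Sys" for i
    using can_trace_obs(1)[OF u] by (auto simp: Ls_def dest!: nth_mem)
  note t = can_trace_obs(2)[OF u]
  have zip: "zip (map Ls [0..<0 + length (map snd u)]) (map snd u) = u"
    by (rule nth_equalityI) (auto simp: Ls_def)
  let ?Env = "injecting_env Sys e Ls"
  note env = fault_environment_injecting_env[where e = e and Ls = Ls and Sys = Sys, OF e Ls]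
  have E: "e 0 \<in> EnvStates ?Env"
    by (simp add: injecting_env_def)
  have "trace_prob Sys ?Env (T, e 0) (map snd u) = (if can_trace Sys T u then 1 else 0)" for T
    using fault_prob_injecting_env[where e = e and Ls = Ls, OF sys e Ls t, of T 0]
    unfolding trace_prob_eq_fault_prob[OF sys env E t] zip .
  \<comment> \<open>The probability is 1 from \<open>S\<close>, hence also from \<open>S'\<close>,
    which excludes the value 0 there.\<close>
  then show ?thesis
    using eq[OF env E t] u by (simp split: if_splits)
qed

theorem theorem1:
  fixes Sys :: "('loc, 'act) system"
    and ProgLoc LowLoc HighLoc :: "'loc set"
    and P :: "'loc \<Rightarrow> bool"
  assumes "fault_prone_system Sys"
    and "ProgLoc \<union> LowLoc \<union> HighLoc = UNIV"
    and "ProgLoc \<inter> LowLoc = {}" and "ProgLoc \<inter> HighLoc = {}" and "LowLoc \<inter> HighLoc = {}"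
    and "P \<in> ProgLoc \<rightarrow>\<^sub>E UNIV"
    and "infinite (UNIV :: 'env set)"
  shows "PNI TYPE('env) Sys ProgLoc LowLoc P \<longleftrightarrow> PoNI Sys ProgLoc LowLoc P"
proof
  assume pni: "PNI TYPE('env) Sys ProgLoc LowLoc P"
  show "PoNI Sys ProgLoc LowLoc P"
    unfolding PoNI_def
  proof (intro allI impI)
    fix S S' u
    assume SS': "restrict S ProgLoc = P \<and> restrict S' ProgLoc = P \<and>
      restrict S LowLoc = restrict S' LowLoc"
    then have eq: "trace_prob Sys Env (S, E) t = trace_prob Sys Env (S', E) t"
      if "fault_environment Sys Env" "E \<in> EnvStates Env" "t \<in> lists (obs Sys)"
      for Env :: "('loc, 'act, 'env) environment" and E t
      using pni that unfolding PNI_def by blast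
    show "can_trace Sys S u \<longleftrightarrow> can_trace Sys S' u"
      using can_trace_transfer[OF assms(1,7), of S S'] can_trace_transfer[OF assms(1,7), of S' S] eq
      by metis
  qed
next
  assume poni: "PoNI Sys ProgLoc LowLoc P"
  show "PNI TYPE('env) Sys ProgLoc LowLoc P"
    unfolding PNI_def
  proof (intro allI impI ballI)
    fix S S' :: "'loc state" and Env :: "('loc, 'act, 'env) environment" and E t
    assume SS': "restrict S ProgLoc = P \<and> restrict S' ProgLoc = P \<and>
        restrict S LowLoc = restrict S' LowLoc"
      and env: "fault_environment Sys Env" and E: "E \<in> EnvStates Env"
      and t: "t \<in> lists (obs Sys)"
    have "can_trace Sys S u \<longleftrightarrow> can_trace Sys S' u" for u
      using poni SS' unfolding PoNI_def by blast
    then show "trace_prob Sys Env (S, E) t = trace_prob Sys Env (S', E) t"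
      unfolding trace_prob_eq_fault_prob[OF assms(1) env E t] by (rule fault_prob_cong[OF assms(1)])
  qed
qed

end
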